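(* Let $r\in\mathbb{N}$ and $C>0$, and set $\delta=(1000r)^{-1}$, $\varepsilon=\delta^{r+2}$ and $n=C(1000r)^{1000r}$. Let $A_1,\dotsc,A_{r-1},A_r$ and $B$ be sets of vertices with sizes $|A_i|=n\delta^i$ and $|B|=n$. Let $G_r$ be the random bipartite graph on parts $B$ and $A:=A_1\cup\cdots\cup A_r$ such that every edge between $b\in B$ and $a_i\in A_i$ is present with probability $\varepsilon\delta^{-i}$, each choice being independent of all others (and there are no other edges). Then there exists a universal threshold $c$ such that for every $C\geq c$ and every $r$, we have $\theta(G_r)\geq r$ with probability at least $1/2$.
   Context: An interval colouring of a graph $G=(V,E)$ is an edge-colouring $c\colon E\to\mathbb{Z}$ such that for every vertex $x$, the multiset of colours of edges incident to $x$ forms an interval of $\mathbb{Z}$ (in particular it is proper). A graph is interval colourable if it admits an interval colouring. The interval thickness $\theta(G)$ is the smallest integer $k$ such that $G$ can be edge-decomposed into $k$ interval colourable graphs. *)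

theory Defs
  imports "HOL-Probability.Probability" "HOL-Library.Multiset"
begin

text \<open>A finite simple graph is given by its vertex set \<open>V\<close> and its edge set \<open>E\<close>,
  whose members are two-element subsets of \<open>V\<close>.\<close>

definition interval_colouring :: "'a set \<Rightarrow> 'a set set \<Rightarrow> ('a set \<Rightarrow> int) \<Rightarrow> bool" where
  "interval_colouring V E c \<longleftrightarrow>
     (\<forall>x\<in>V. \<exists>a b. image_mset c (mset_set {e \<in> E. x \<in> e}) = mset_set {a..b})"

text \<open>The right-hand side has multiplicities at most one, so such a colouring is proper.
  The interval may be empty (\<open>b < a\<close>), which is the case of an isolated vertex.\<close>

definition interval_colourable :: "'a set \<Rightarrow> 'a set set \<Rightarrow> bool" where
  "interval_colourable V E \<longleftrightarrow> (\<exists>c. interval_colouring V E c)"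

definition interval_decomposable :: "'a set \<Rightarrow> 'a set set \<Rightarrow> nat \<Rightarrow> bool" where
  "interval_decomposable V E k \<longleftrightarrow>
     (\<exists>F. (\<Union>j<k. F j) = E \<and> disjoint_family_on F {..<k} \<and>
          (\<forall>j<k. interval_colourable V (F j)))"

definition interval_thickness :: "'a set \<Rightarrow> 'a set set \<Rightarrow> nat" where
  "interval_thickness V E = (LEAST k. interval_decomposable V E k)"

text \<open>The least \<open>k\<close> exists for every finite graph, since single edges are interval colourable.\<close>

text \<open>The distribution of the edge set of the random bipartite graph with parts \<open>B\<close> and
  \<open>A 1 \<union> \<dots> \<union> A r\<close> (all of these sets pairwise disjoint), where every edge between
  \<open>A i\<close> and \<open>B\<close> is present with probability \<open>p i\<close>, independently of all others.\<close>

definition random_bipartite_edges ::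
    "nat \<Rightarrow> (nat \<Rightarrow> 'a set) \<Rightarrow> 'a set \<Rightarrow> (nat \<Rightarrow> real) \<Rightarrow> 'a set set pmf" where
  "random_bipartite_edges r A B p =
     map_pmf (\<lambda>present. {{a, b} | i a b. i \<in> {1..r} \<and> a \<in> A i \<and> b \<in> B \<and> present (i, a, b)})
       (Pi_pmf (SIGMA i:{1..r}. A i \<times> B) False (\<lambda>(i, a, b). bernoulli_pmf (p i)))"

end

(* Suppose G splits into k < r interval coloured classes. A vertex a of A_i sees at most d_j(a) consecutive
   colours in class j, and b in B has small degree, so for another vertex a' the class-j edges from a'
   into the set S(a, j) of those b that meet the colours of a number at most d_j(a) + O(deg b). Degrees in
   A_i exceed those in the earlier A_i' by factors of 1000 r, hence only few edges from a_i lie, within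
   their own class j, in sets S(a_i', j) with i' < i. If G is pseudorandom, one can therefore choose
   a_1, ..., a_r in turn such that for each i all but few b lie in some S(a_i, j) but in no S(a_i', j)
   with i' < i. Some b survives for all i, and then the classes j used for i = 1, ..., r are
   distinct, which contradicts k < r.

   The sets occurring here depend on the colouring. They are cut out by comparing end points of
   colour intervals, so there are only exp (O(r n log n)) of them, while each one fails to
   contain its share of the edges with probability exp (- c n^2): a union bound suffices. *)
theory Submission
  imports Defs
begin

section \<open>Tail bounds for sums of independent Bernoulli variables\<close>

text \<open>Independence factors the moment generating function over the index set, and each factor
  is bounded by \<open>1 + x \<le> exp x\<close>. The sign of \<open>s\<close> is left open so that
  one bound serves both tails.\<close>

lemma expectation_exp_card_Pi_pmf_bernoulli:
  fixes p :: "'i \<Rightarrow> real" and s :: real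
  assumes "finite I" "Q \<subseteq> I" "\<And>q. q \<in> I \<Longrightarrow> 0 \<le> p q \<and> p q \<le> 1"
  defines "M \<equiv> Pi_pmf I False (\<lambda>q. bernoulli_pmf (p q))"
  shows "measure_pmf.expectation M (\<lambda>f. exp (s * card {q\<in>Q. f q})) \<le> exp ((exp s - 1) * sum p Q)"
proof -
  \<comment> \<open>The value 1 outside \<open>Q\<close> lets the product run over all of
    \<open>I\<close>, where independence applies.\<close>
  define h where "h q v = (if q \<in> Q then exp (s * of_bool v) else 1)" for q and v :: bool
  have fQ: "finite Q"
    using assms(1,2) finite_subset by blast
  have "exp (s * card {q\<in>Q. f q}) = (\<Prod>q\<in>I. h q (f q))" for f
  proof -
    have "(\<Prod>q\<in>I. h q (f q)) = (\<Prod>q\<in>Q. exp (s * of_bool (f q)))"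
      using assms(1,2) by (intro prod.mono_neutral_cong_right) (auto simp: h_def)
    also have "\<dots> = exp (s * (\<Sum>q\<in>Q. of_bool (f q)))"
      unfolding sum_distrib_left using fQ by (rule exp_sum[symmetric])
    also have "(\<Sum>q\<in>Q. of_bool (f q)) = real (card {q\<in>Q. f q})"
      using fQ by (simp add: sum.If_cases of_bool_def Int_def)
    finally show ?thesis by simp
  qed
  then have "measure_pmf.expectation M (\<lambda>f. exp (s * card {q\<in>Q. f q}))
      = measure_pmf.expectation M (\<lambda>f. \<Prod>q\<in>I. h q (f q))"
    by simp
  also have "\<dots> = (\<Prod>q\<in>I. measure_pmf.expectation (bernoulli_pmf (p q)) (h q))"
    unfolding M_def using assms(1)
    by (intro expectation_prod_Pi_pmf)
      (auto simp: h_def intro: integrable_measure_pmf_finite)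
  also have "\<dots> = (\<Prod>q\<in>Q. 1 + p q * (exp s - 1))"
    using assms by (intro prod.mono_neutral_cong_right) (auto simp: h_def algebra_simps subset_iff)
  also have "\<dots> \<le> (\<Prod>q\<in>Q. exp (p q * (exp s - 1)))"
  proof (rule prod_mono)
    fix q assume "q \<in> Q"
    then have "0 \<le> p q" "p q \<le> 1" using assms by auto
    then have "0 \<le> (1 - p q) + p q * exp s" by simp
    then show "0 \<le> 1 + p q * (exp s - 1) \<and> 1 + p q * (exp s - 1) \<le> exp (p q * (exp s - 1))"
      using exp_ge_add_one_self[of "p q * (exp s - 1)"] by (simp add: algebra_simps)
  qed
  also have "\<dots> = exp ((exp s - 1) * sum p Q)"
    using fQ by (simp add: exp_sum[symmetric] sum_distrib_right mult.commute)
  finally show ?thesis .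
qed

lemma integrable_exp_card_measure_pmf:
  fixes s :: real
  assumes "finite Q"
  shows "integrable (measure_pmf M) (\<lambda>f. exp (s * card {q\<in>Q. f q}))"
proof (rule measure_pmf.integrable_const_bound)
  show "AE f in measure_pmf M. norm (exp (s * card {q\<in>Q. f q})) \<le> exp (\<bar>s\<bar> * card Q)"
  proof (rule AE_I2)
    fix f :: "'a \<Rightarrow> bool"
    have "s * card {q\<in>Q. f q} \<le> \<bar>s\<bar> * card {q\<in>Q. f q}"
      by (intro mult_right_mono) auto
    also have "\<dots> \<le> \<bar>s\<bar> * card Q"
      using card_mono[OF assms, of "{q\<in>Q. f q}"] by (intro mult_left_mono) auto
    finally show "norm (exp (s * card {q\<in>Q. f q})) \<le> exp (\<bar>s\<bar> * card Q)"
      by simp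
  qed
qed simp

text \<open>Markov's inequality for the exponential moment. Multiplying both sides of the event by
  \<open>s\<close> makes it the upper tail for positive \<open>s\<close> and the lower tail for
  negative \<open>s\<close>.\<close>

lemma prob_exp_card_Pi_pmf_bernoulli:
  fixes p :: "'i \<Rightarrow> real" and s t :: real
  assumes "finite I" "Q \<subseteq> I" "\<And>q. q \<in> I \<Longrightarrow> 0 \<le> p q \<and> p q \<le> 1"
  defines "M \<equiv> Pi_pmf I False (\<lambda>q. bernoulli_pmf (p q))"
  shows "measure_pmf.prob M {f. s * t \<le> s * card {q\<in>Q. f q}} \<le> exp ((exp s - 1) * sum p Q - s * t)"
proof -
  have "measure_pmf.prob M {f. s * t \<le> s * card {q\<in>Q. f q}}
      = measure_pmf.prob M {f\<in>space (measure_pmf M). exp (s * t) \<le> exp (s * card {q\<in>Q. f q})}"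
    by simp
  also have "\<dots> \<le> measure_pmf.expectation M (\<lambda>f. exp (s * card {q\<in>Q. f q})) / exp (s * t)"
    using assms(1,2) finite_subset
    by (intro integral_Markov_inequality_measure[where A = "{}"] integrable_exp_card_measure_pmf) auto
  also have "\<dots> \<le> exp ((exp s - 1) * sum p Q) / exp (s * t)"
    unfolding M_def
    by (intro divide_right_mono expectation_exp_card_Pi_pmf_bernoulli assms) auto
  finally show ?thesis by (simp add: exp_diff)
qed

lemma prob_card_ge_Pi_pmf_bernoulli:
  fixes p :: "'i \<Rightarrow> real" and \<mu> :: real
  assumes "finite I" "Q \<subseteq> I" "\<And>q. q \<in> I \<Longrightarrow> 0 \<le> p q \<and> p q \<le> 1" "sum p Q \<le> \<mu>"
  shows "measure_pmf.prob (Pi_pmf I False (\<lambda>q. bernoulli_pmf (p q)))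
           {f. 2 * \<mu> \<le> card {q\<in>Q. f q}} \<le> exp (- \<mu> / 4)"
proof -
  have "0 \<le> sum p Q" using assms by (intro sum_nonneg) auto
  then have "0 \<le> \<mu>" using assms by simp
  have "measure_pmf.prob (Pi_pmf I False (\<lambda>q. bernoulli_pmf (p q))) {f. 2 * \<mu> \<le> card {q\<in>Q. f q}}
      \<le> exp ((exp 1 - 1) * sum p Q - 2 * \<mu>)"
    using prob_exp_card_Pi_pmf_bernoulli[OF assms(1-3), where s = 1 and t = "2 * \<mu>"] by simp
  \<comment> \<open>The bound \<open>e < 2.72\<close> gives \<open>exp 1 - 1 \<le> 7 / 4\<close>,
    which leaves the coefficient 7/4 - 2 = -1/4 in the exponent.\<close>
  also have "(exp 1 - 1) * sum p Q \<le> (7 / 4) * \<mu>"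
    using \<open>0 \<le> sum p Q\<close> assms(4) e_less_272 by (intro mult_mono) auto
  finally show ?thesis by simp
qed

lemma prob_card_le_Pi_pmf_bernoulli:
  fixes p :: "'i \<Rightarrow> real"
  assumes "finite I" "Q \<subseteq> I" "\<And>q. q \<in> I \<Longrightarrow> 0 \<le> p q \<and> p q \<le> 1"
  shows "measure_pmf.prob (Pi_pmf I False (\<lambda>q. bernoulli_pmf (p q)))
           {f. card {q\<in>Q. f q} \<le> sum p Q / 2} \<le> exp (- sum p Q / 10)"
proof -
  have "0 \<le> sum p Q" using assms by (intro sum_nonneg) auto
  \<comment> \<open>Here \<open>s = -1\<close>. Bounding \<open>exp (- 1)\<close> by 2/5 leaves the
    coefficient -3/5 + 1/2 = -1/10.\<close>
  have "1 + 1 + 1 / 2 \<le> exp (1::real)"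
    using exp_lower_Taylor_quadratic[of "1::real"] by simp
  then have "exp (- 1) \<le> (2 / 5 :: real)"
    by (simp add: exp_minus field_simps)
  then have "(exp (-1) - 1) * sum p Q \<le> (- 3 / 5) * sum p Q"
    using \<open>0 \<le> sum p Q\<close> by (intro mult_right_mono) auto
  moreover have "measure_pmf.prob (Pi_pmf I False (\<lambda>q. bernoulli_pmf (p q)))
      {f. card {q\<in>Q. f q} \<le> sum p Q / 2} \<le> exp ((exp (-1) - 1) * sum p Q + sum p Q / 2)"
    using prob_exp_card_Pi_pmf_bernoulli[OF assms, where s = "-1" and t = "sum p Q / 2"] by simp
  ultimately show ?thesis
    by (elim order_trans) simp
qed

section \<open>Threshold relations\<close>

text \<open>Labels are restricted to \<open>{..card B}\<close> so that the family is finite and can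
  be counted independently of any colouring; arbitrary ordered labels give no further
  relations.\<close>

definition threshold_relations :: "'a set \<Rightarrow> 'b set \<Rightarrow> ('a \<times> 'b) set set" where
  "threshold_relations A B =
     (\<lambda>(f, g). {(a, b) \<in> A \<times> B. f b \<le> g a}) ` ((B \<rightarrow>\<^sub>E {..card B}) \<times> (A \<rightarrow>\<^sub>E {..card B}))"

text \<open>Every label \<open>x\<close> is replaced by its rank \<open>F x\<close> among the values
  of \<open>f\<close>. Ranks preserve the comparison: if \<open>f b \<le> g a\<close> fails, then
  \<open>b\<close> itself is counted by \<open>F (f b)\<close> but not by \<open>F (g a)\<close>.
  The label type is an arbitrary linear order because both integers and extended reals are used
  later.\<close>

lemma threshold_relationsI:
  fixes f :: "'b \<Rightarrow> 'l::linorder" and g :: "'a \<Rightarrow> 'l"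
  assumes "finite B"
  shows "{(a, b) \<in> A \<times> B. f b \<le> g a} \<in> threshold_relations A B"
proof -
  define F where "F x = card {b'\<in>B. f b' \<le> x}" for x
  have F: "F (f b) \<le> F (g a) \<longleftrightarrow> f b \<le> g a" if "b \<in> B" for a b
  proof
    assume "f b \<le> g a"
    then show "F (f b) \<le> F (g a)"
      unfolding F_def using assms by (intro card_mono) auto
  next
    assume *: "F (f b) \<le> F (g a)"
    show "f b \<le> g a"
    proof (rule ccontr)
      assume "\<not> f b \<le> g a"
      then have "{b'\<in>B. f b' \<le> g a} \<subset> {b'\<in>B. f b' \<le> f b}"
        using that by auto
      then have "F (g a) < F (f b)"
        unfolding F_def using assms by (intro psubset_card_mono) auto
      then show False using * by simp
    qed
  qed
  have "F x \<le> card B" for x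
    unfolding F_def using assms by (intro card_mono) auto
  then have "(restrict (F \<circ> f) B, restrict (F \<circ> g) A) \<in> (B \<rightarrow>\<^sub>E {..card B}) \<times> (A \<rightarrow>\<^sub>E {..card B})"
    by auto
  moreover have "{(a, b) \<in> A \<times> B. f b \<le> g a}
      = (\<lambda>(f, g). {(a, b) \<in> A \<times> B. f b \<le> g a}) (restrict (F \<circ> f) B, restrict (F \<circ> g) A)"
    using F by auto
  ultimately show ?thesis
    unfolding threshold_relations_def by (rule rev_image_eqI)
qed

lemma finite_threshold_relations: "finite A \<Longrightarrow> finite B \<Longrightarrow> finite (threshold_relations A B)"
  by (simp add: threshold_relations_def finite_PiE)

lemma card_threshold_relations:
  assumes "finite A" "finite B"
  shows "card (threshold_relations A B) \<le> (card B + 1) ^ (card B + card A)"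
proof -
  have "card (threshold_relations A B) \<le> card ((B \<rightarrow>\<^sub>E {..card B}) \<times> (A \<rightarrow>\<^sub>E {..card B}))"
    unfolding threshold_relations_def using assms by (intro card_image_le) (simp add: finite_PiE)
  also have "\<dots> = (card B + 1) ^ (card B + card A)"
    using assms by (simp add: card_cartesian_product card_PiE power_add)
  finally show ?thesis .
qed

text \<open>Two nonempty integer intervals meet iff each begins no later than the other ends. So
  \<open>R j \<inter> R' j\<close> can express that the colour intervals of \<open>a\<close> and
  \<open>b\<close> meet in class \<open>j\<close>, and the members of the family collect the pairs
  for which this happens in no class.\<close>

definition threshold_complements :: "nat \<Rightarrow> 'a set \<Rightarrow> 'b set \<Rightarrow> ('a \<times> 'b) set set" where
  "threshold_complements r A B =
     (\<lambda>(R, R'). A \<times> B - (\<Union>j<r. R j \<inter> R' j)) `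
       (({..<r} \<rightarrow>\<^sub>E threshold_relations A B) \<times> ({..<r} \<rightarrow>\<^sub>E threshold_relations A B))"

lemma threshold_complementsI:
  assumes "\<And>j. j < r \<Longrightarrow> R j \<in> threshold_relations A B"
    and "\<And>j. j < r \<Longrightarrow> R' j \<in> threshold_relations A B"
  shows "A \<times> B - (\<Union>j<r. R j \<inter> R' j) \<in> threshold_complements r A B"
  unfolding threshold_complements_def
  by (rule rev_image_eqI[of "(restrict R {..<r}, restrict R' {..<r})"]) (use assms in auto)

lemma threshold_complements_subset: "P \<in> threshold_complements r A B \<Longrightarrow> P \<subseteq> A \<times> B"
  by (auto simp: threshold_complements_def)

lemma finite_threshold_complements:
  "finite A \<Longrightarrow> finite B \<Longrightarrow> finite (threshold_complements r A B)"
  by (simp add: threshold_complements_def finite_PiE finite_threshold_relations)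

lemma card_threshold_complements:
  assumes "finite A" "finite B"
  shows "card (threshold_complements r A B) \<le> (card B + 1) ^ (2 * r * (card B + card A))"
proof -
  let ?T = "threshold_relations A B"
  have "card (threshold_complements r A B) \<le> card (({..<r} \<rightarrow>\<^sub>E ?T) \<times> ({..<r} \<rightarrow>\<^sub>E ?T))"
    unfolding threshold_complements_def using assms
    by (intro card_image_le) (simp add: finite_PiE finite_threshold_relations)
  also have "\<dots> = card ?T ^ (2 * r)"
    by (simp add: card_cartesian_product card_PiE mult_2 power_add)
  also have "\<dots> \<le> ((card B + 1) ^ (card B + card A)) ^ (2 * r)"
    by (intro power_mono card_threshold_relations assms) simp
  finally show ?thesis
    by (simp add: power_mult[symmetric] mult.commute)
qed

section \<open>Decompositions into interval colourable graphs\<close>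

lemma interval_colouring_incident:
  assumes "interval_colouring V E c" "finite E" "x \<in> V"
  obtains l h where "inj_on c {e\<in>E. x \<in> e}" "c ` {e\<in>E. x \<in> e} = {l..h}"
proof -
  let ?S = "{e\<in>E. x \<in> e}"
  obtain l h where eq: "image_mset c (mset_set ?S) = mset_set {l..h}"
    using assms unfolding interval_colouring_def by blast
  have "set_mset (image_mset c (mset_set ?S)) = set_mset (mset_set {l..h})"
    using eq by simp
  then have im: "c ` ?S = {l..h}"
    using assms(2) by simp
  \<comment> \<open>Comparing sizes shows that there are as many colours as edges at
    \<open>x\<close>, which yields injectivity.\<close>
  have "size (image_mset c (mset_set ?S)) = size (mset_set {l..h})"
    using eq by simp
  then have "card ?S = card (c ` ?S)"
    by (simp add: im)
  then have "inj_on c ?S"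
    using assms(2) by (intro eq_card_imp_inj_on) auto
  then show ?thesis using im that by blast
qed

text \<open>The colours at \<open>a\<close> fill an interval. Each \<open>b\<close> in
  \<open>W\<close> has at most \<open>\<Delta>\<close> colours, and they form an interval meeting
  that of \<open>a\<close>, so they stay within distance \<open>\<Delta>\<close> of it. Edges from
  \<open>x\<close> into \<open>W\<close> have distinct colours, all in this widened window.\<close>

lemma card_edges_into_colour_window:
  assumes c: "interval_colouring V F c" and fin: "finite F" and "a \<in> V" "x \<in> V" "W \<subseteq> V"
    and deg: "\<And>b. b \<in> W \<Longrightarrow> card {e\<in>F. b \<in> e} \<le> \<Delta>"
    and meet: "\<And>b. b \<in> W \<Longrightarrow> c ` {e\<in>F. a \<in> e} \<inter> c ` {e\<in>F. b \<in> e} \<noteq> {}"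
  shows "card {b\<in>W. {x, b} \<in> F} \<le> card {e\<in>F. a \<in> e} + 2 * \<Delta>"
proof (cases "{b\<in>W. {x, b} \<in> F} = {}")
  case False
  let ?X = "{b\<in>W. {x, b} \<in> F}"
  obtain l h where inja: "inj_on c {e\<in>F. a \<in> e}" and ima: "c ` {e\<in>F. a \<in> e} = {l..h}"
    using interval_colouring_incident[OF c fin \<open>a \<in> V\<close>] .
  \<comment> \<open>The length formula \<open>h - l + 1\<close> fails for a general empty interval;
    a vertex \<open>b\<close> with an edge from \<open>x\<close> excludes this case through
    \<open>meet\<close>.\<close>
  have "l \<le> h" using False meet ima by fastforce
  have "card {e\<in>F. a \<in> e} = card {l..h}"
    using card_image[OF inja] ima by simp
  then have dega: "int (card {e\<in>F. a \<in> e}) = h - l + 1"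
    using \<open>l \<le> h\<close> by simp
  have injx: "inj_on c {e\<in>F. x \<in> e}"
    using interval_colouring_incident[OF c fin \<open>x \<in> V\<close>] .
  have inj: "inj_on (\<lambda>b. c {x, b}) ?X"
  proof (rule inj_onI)
    fix b b' assume "b \<in> ?X" "b' \<in> ?X" "c {x, b} = c {x, b'}"
    then have "{x, b} = {x, b'}"
      using injx by (auto dest: inj_onD)
    then show "b = b'" by (auto simp: doubleton_eq_iff)
  qed
  have "(\<lambda>b. c {x, b}) ` ?X \<subseteq> {l - int \<Delta>..h + int \<Delta>}"
  proof clarify
    fix b assume b: "b \<in> W" "{x, b} \<in> F"
    then have "b \<in> V" using \<open>W \<subseteq> V\<close> by auto
    obtain l' h' where injb: "inj_on c {e\<in>F. b \<in> e}" and imb: "c ` {e\<in>F. b \<in> e} = {l'..h'}"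
      using interval_colouring_incident[OF c fin \<open>b \<in> V\<close>] .
    have "card {l'..h'} \<le> \<Delta>"
      using card_image[OF injb] imb deg[OF b(1)] by simp
    moreover have "{l..h} \<inter> {l'..h'} \<noteq> {}"
      using meet[OF b(1)] ima imb by simp
    moreover have "c {x, b} \<in> {l'..h'}"
      using b(2) imb by blast
    ultimately show "c {x, b} \<in> {l - int \<Delta>..h + int \<Delta>}"
      by auto
  qed
  then have "card ?X \<le> card {l - int \<Delta>..h + int \<Delta>}"
    using inj by (intro card_inj_on_le[OF inj]) auto
  then show ?thesis using dega by auto
next
  case True
  then show ?thesis by (simp only: card.empty)
qed

section \<open>Existence of the interval thickness for finite graphs\<close>

lemma interval_decomposable_card_edges:
  assumes "finite E"
  shows "interval_decomposable V E (card E)"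
proof -
  obtain g where g: "bij_betw g {..<card E} E"
    using ex_bij_betw_nat_finite[OF assms] by (auto simp: atLeast0LessThan)
  have "interval_colourable V {e}" for e
  proof -
    have "\<exists>a b. image_mset (\<lambda>_. 0 :: int) (mset_set {e' \<in> {e}. x \<in> e'}) = mset_set {a..b}" for x
    proof (cases "x \<in> e")
      case True
      then have "{e' \<in> {e}. x \<in> e'} = {e}" by auto
      then show ?thesis by (intro exI[of _ 0]) simp
    next
      case False
      then have "{e' \<in> {e}. x \<in> e'} = {}" by auto
      \<comment> \<open>A vertex off the edge sees no colour; \<open>{1..0}\<close> is the empty
        interval.\<close>
      then show ?thesis by (intro exI[of _ 1] exI[of _ 0]) (simp del: Collect_empty_eq)
    qed
    then show ?thesis
      unfolding interval_colourable_def interval_colouring_def by blast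
  qed
  moreover have "(\<Union>j<card E. {g j}) = E"
    using bij_betw_imp_surj_on[OF g] by auto
  moreover have "disjoint_family_on (\<lambda>j. {g j}) {..<card E}"
    using bij_betw_imp_inj_on[OF g] by (auto simp: disjoint_family_on_def inj_on_def)
  ultimately show ?thesis
    unfolding interval_decomposable_def by (intro exI[of _ "\<lambda>j. {g j}"]) auto
qed

text \<open>Since the minimum is attained, a lower bound on the thickness follows once a
  decomposition into exactly that many classes is refuted.\<close>

lemma interval_decomposable_interval_thickness:
  "finite E \<Longrightarrow> interval_decomposable V E (interval_thickness V E)"
  unfolding interval_thickness_def by (rule LeastI_ex) (use interval_decomposable_card_edges in blast)

text \<open>The deterministic core. \<open>\<tau> i\<close> is the share of \<open>B\<close> that
  step \<open>i\<close> may lose. By \<open>regular\<close>, every large set of the family has more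
  edges per vertex of \<open>A i\<close> than the colour windows of the earlier vertices can
  hold.\<close>

lemma not_interval_decomposable:
  fixes A :: "nat \<Rightarrow> 'a set" and B :: "'a set" and \<tau> D :: "nat \<Rightarrow> real" and \<Delta> :: nat
  assumes finE: "finite E" and finB: "finite B" and BV: "B \<subseteq> V"
    and finA: "\<And>i. i \<in> {1..r} \<Longrightarrow> finite (A i)" and AV: "\<And>i. i \<in> {1..r} \<Longrightarrow> A i \<subseteq> V"
    and degB: "\<And>b. b \<in> B \<Longrightarrow> card {e\<in>E. b \<in> e} \<le> \<Delta>"
    and degA: "\<And>i a. i \<in> {1..r} \<Longrightarrow> a \<in> A i \<Longrightarrow> card {e\<in>E. a \<in> e} \<le> D i"
    and regular: "\<And>i P. i \<in> {1..r} \<Longrightarrow> P \<in> threshold_complements r (A i) B \<Longrightarrow>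
        \<tau> i * card B * card (A i) \<le> card P \<Longrightarrow>
        (\<Sum>i'\<in>{1..<i}. D i' + 2 * real r * \<Delta>) * card (A i) < card {(a, b) \<in> P. {a, b} \<in> E}"
    and \<tau>: "(\<Sum>i\<in>{1..r}. \<tau> i) \<le> 1" and "k < r"
  shows "\<not> interval_decomposable V E k"
proof
  assume "interval_decomposable V E k"
  then obtain F where UF: "(\<Union>j<k. F j) = E" and disjF: "disjoint_family_on F {..<k}"
    and "\<forall>j<k. interval_colourable V (F j)"
    unfolding interval_decomposable_def by blast
  then obtain c where c: "\<And>j. j < k \<Longrightarrow> interval_colouring V (F j) (c j)"
    unfolding interval_colourable_def by metis
  have FE: "F j \<subseteq> E" if "j < k" for j
    using UF that by auto
  then have finF: "finite (F j)" if "j < k" for j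
    using finE that finite_subset by blast
  define K where "K j x = c j ` {e\<in>F j. x \<in> e}" for j x
  have "\<exists>l h. K j x = {l..h}" if "j < k" "x \<in> V" for j x
    using interval_colouring_incident[OF c[OF that(1)] finF[OF that(1)] that(2)]
    unfolding K_def by metis
  then obtain lo hi where K: "\<And>j x. j < k \<Longrightarrow> x \<in> V \<Longrightarrow> K j x = {lo j x..hi j x}"
    by metis
  define S where "S a j = {b\<in>B. K j a \<inter> K j b \<noteq> {}}" for a j
  \<comment> \<open>The vertices for which choosing \<open>a\<close> in step \<open>i\<close> yields no class unused in the earlier steps.\<close>
  define T where "T \<alpha> i a = {b\<in>B. \<forall>j<k. b \<in> S a j \<longrightarrow> (\<exists>i'\<in>{1..<i}. b \<in> S (\<alpha> i') j)}"
    for \<alpha> :: "nat \<Rightarrow> 'a" and i :: nat and a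

  \<comment> \<open>Because the classes are disjoint, adding the window bounds over all classes
    costs the degree of the earlier vertex only once; just the \<open>\<Delta>\<close> term is
    multiplied by the number of classes.\<close>
  have sum_deg: "(\<Sum>j<k. card {e\<in>F j. x \<in> e}) \<le> card {e\<in>E. x \<in> e}" for x
  proof -
    have "(\<Sum>j<k. card {e\<in>F j. x \<in> e}) = card (\<Union>j<k. {e\<in>F j. x \<in> e})"
      using disjF finF by (intro card_UN_disjoint[symmetric]) (auto simp: disjoint_family_on_def)
    also have "\<dots> \<le> card {e\<in>E. x \<in> e}"
      using FE finE by (intro card_mono) auto
    finally show ?thesis .
  qed

  \<comment> \<open>The colour of an edge from \<open>a\<close> to \<open>b\<close> in class
    \<open>j\<close> occurs at both ends, so \<open>b \<in> S a j\<close>. If \<open>b\<close> lies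
    in \<open>T \<alpha> i a\<close>, then \<open>b\<close> is also in the window of an earlier
    \<open>\<alpha> i'\<close> for the same class, where such edges are few.\<close>
  have step_edges: "card {b\<in>T \<alpha> i a. {a, b} \<in> E} \<le> (\<Sum>i'\<in>{1..<i}. D i' + 2 * real r * \<Delta>)"
    if i: "i \<in> {1..r}" and a: "a \<in> A i" and \<alpha>: "\<And>i'. i' \<in> {1..<i} \<Longrightarrow> \<alpha> i' \<in> A i'" for \<alpha> i a
  proof -
    have aV: "a \<in> V" using a AV i by auto
    let ?X = "\<lambda>i' j. {b\<in>S (\<alpha> i') j. {a, b} \<in> F j}"
    have finX: "finite (?X i' j)" for i' j
      using finB by (auto simp: S_def)
    have "{b\<in>T \<alpha> i a. {a, b} \<in> E} \<subseteq> (\<Union>i'\<in>{1..<i}. \<Union>j<k. ?X i' j)"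
    proof clarify
      fix b assume b: "b \<in> T \<alpha> i a" "{a, b} \<in> E"
      then obtain j where j: "j < k" "{a, b} \<in> F j" using UF by auto
      have "b \<in> B" using b by (simp add: T_def)
      moreover have "c j {a, b} \<in> K j a \<inter> K j b"
        using j unfolding K_def by auto
      ultimately have "b \<in> S a j" unfolding S_def by blast
      then obtain i' where "i' \<in> {1..<i}" "b \<in> S (\<alpha> i') j"
        using b j unfolding T_def by blast
      then show "b \<in> (\<Union>i'\<in>{1..<i}. \<Union>j<k. ?X i' j)"
        using j by blast
    qed
    then have "card {b\<in>T \<alpha> i a. {a, b} \<in> E} \<le> card (\<Union>i'\<in>{1..<i}. \<Union>j<k. ?X i' j)"
      using finX by (intro card_mono) auto
    also have "\<dots> \<le> (\<Sum>i'\<in>{1..<i}. card (\<Union>j<k. ?X i' j))"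
      by (rule card_UN_le) simp
    finally have "real (card {b\<in>T \<alpha> i a. {a, b} \<in> E}) \<le> (\<Sum>i'\<in>{1..<i}. real (card (\<Union>j<k. ?X i' j)))"
      by (simp flip: of_nat_sum)
    also have "\<dots> \<le> (\<Sum>i'\<in>{1..<i}. D i' + 2 * real r * \<Delta>)"
    proof (rule sum_mono)
      fix i' assume i': "i' \<in> {1..<i}"
      then have \<alpha>A: "\<alpha> i' \<in> A i'" and i'r: "i' \<in> {1..r}" using \<alpha> i by auto
      then have \<alpha>V: "\<alpha> i' \<in> V" using AV by blast
      have "card (\<Union>j<k. ?X i' j) \<le> (\<Sum>j<k. card (?X i' j))"
        by (rule card_UN_le) simp
      also have "\<dots> \<le> (\<Sum>j<k. card {e\<in>F j. \<alpha> i' \<in> e} + 2 * \<Delta>)"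
      proof (rule sum_mono)
        fix j assume "j \<in> {..<k}"
        then have j: "j < k" by simp
        show "card (?X i' j) \<le> card {e\<in>F j. \<alpha> i' \<in> e} + 2 * \<Delta>"
        proof (rule card_edges_into_colour_window[OF c[OF j] finF[OF j] \<alpha>V aV])
          show "S (\<alpha> i') j \<subseteq> V" using BV by (auto simp: S_def)
        next
          fix b assume "b \<in> S (\<alpha> i') j"
          then have "b \<in> B" and "K j (\<alpha> i') \<inter> K j b \<noteq> {}" by (auto simp: S_def)
          then show "c j ` {e \<in> F j. \<alpha> i' \<in> e} \<inter> c j ` {e \<in> F j. b \<in> e} \<noteq> {}"
            by (simp add: K_def)
          have "card {e\<in>F j. b \<in> e} \<le> card {e\<in>E. b \<in> e}"
            using FE[OF j] finE by (intro card_mono) auto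
          then show "card {e\<in>F j. b \<in> e} \<le> \<Delta>"
            using degB[OF \<open>b \<in> B\<close>] by simp
        qed
      qed
      also have "\<dots> \<le> card {e\<in>E. \<alpha> i' \<in> e} + 2 * r * \<Delta>"
        using sum_deg[of "\<alpha> i'"] \<open>k < r\<close> by (simp add: sum.distrib add_mono)
      finally have "card (\<Union>j<k. ?X i' j) \<le> card {e\<in>E. \<alpha> i' \<in> e} + 2 * r * \<Delta>" .
      then have "real (card (\<Union>j<k. ?X i' j)) \<le> real (card {e\<in>E. \<alpha> i' \<in> e} + 2 * r * \<Delta>)"
        by (rule of_nat_mono)
      then show "real (card (\<Union>j<k. ?X i' j)) \<le> D i' + 2 * real r * \<Delta>"
        using degA[OF i'r \<alpha>A] by (simp add: mult.assoc)
    qed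
    finally show ?thesis .
  qed

  \<comment> \<open>Although the set depends on the colouring and on \<open>\<alpha>\<close>, it
    belongs to a family fixed in advance, which is what makes \<open>regular\<close>
    applicable.\<close>
  have family: "{(a, b). a \<in> A i \<and> b \<in> T \<alpha> i a} \<in> threshold_complements r (A i) B"
    if i: "i \<in> {1..r}" for \<alpha> i
  proof -
    let ?U = "\<lambda>j. \<Union>i'\<in>{1..<i}. S (\<alpha> i') j"
    \<comment> \<open>Infinite end points encode empty colour intervals and the excluded vertices in \<open>?U j\<close>.\<close>
    define f g where "f j b = (if j < k \<and> lo j b \<le> hi j b \<and> b \<notin> ?U j then ereal (lo j b) else \<infinity>)"
      and "g j a = (if lo j a \<le> hi j a then ereal (hi j a) else - \<infinity>)" for j a b
    \<comment> \<open>\<open>R\<close> compares the lower end at \<open>b\<close> with the upper end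
      at \<open>a\<close>; \<open>R'\<close> compares the other two ends, negated to put the label
      of \<open>b\<close> on the left. For \<open>k \<le> j\<close> the relation \<open>R j\<close>
      is empty, since \<open>f j b\<close> is infinite and \<open>g j a\<close> never is; this pads
      the \<open>k\<close> classes to \<open>r\<close> indices.\<close>
    define R R' where "R j = {(a, b) \<in> A i \<times> B. f j b \<le> g j a}"
      and "R' j = {(a, b) \<in> A i \<times> B. - hi j b \<le> - lo j a}" for j
    have "(a, b) \<in> R j \<inter> R' j \<longleftrightarrow> j < k \<and> b \<in> S a j \<and> b \<notin> ?U j" if "a \<in> A i" "b \<in> B" for a b j
    proof (cases "j < k \<and> b \<notin> ?U j")
      case True
      have "a \<in> V" "b \<in> V" using that AV[OF i] BV by auto
      then have "b \<in> S a j \<longleftrightarrow> {lo j a..hi j a} \<inter> {lo j b..hi j b} \<noteq> {}"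
        using True that K by (simp add: S_def)
      also have "\<dots> \<longleftrightarrow> lo j a \<le> hi j a \<and> lo j b \<le> hi j b \<and> lo j b \<le> hi j a \<and> lo j a \<le> hi j b"
        by auto
      finally show ?thesis
        using True that by (auto simp: R_def R'_def f_def g_def)
    next
      case False
      then have "f j b = \<infinity>" by (auto simp: f_def)
      moreover have "g j a \<noteq> \<infinity>" by (simp add: g_def)
      ultimately show ?thesis using False by (auto simp: R_def)
    qed
    then have "{(a, b). a \<in> A i \<and> b \<in> T \<alpha> i a} = A i \<times> B - (\<Union>j<r. R j \<inter> R' j)"
      using \<open>k < r\<close> by (auto simp: T_def) (meson less_trans)+
    moreover have "R j \<in> threshold_relations (A i) B" "R' j \<in> threshold_relations (A i) B" for j
      unfolding R_def R'_def by (intro threshold_relationsI finB)+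
    ultimately show ?thesis
      by (simp add: threshold_complementsI)
  qed

  \<comment> \<open>Averaging over \<open>a\<close>: if every choice lost too much of
    \<open>B\<close>, the sets \<open>T \<alpha> i a\<close> together would form a large member of
    the family, and the edge count from \<open>regular\<close> would exceed the sum of the bounds
    from \<open>step_edges\<close>.\<close>
  have step: "\<exists>a\<in>A i. card (T \<alpha> i a) < \<tau> i * card B"
    if i: "i \<in> {1..r}" and \<alpha>: "\<And>i'. i' \<in> {1..<i} \<Longrightarrow> \<alpha> i' \<in> A i'" for \<alpha> i
  proof (rule ccontr)
    assume "\<not> ?thesis"
    then have large: "\<tau> i * card B \<le> card (T \<alpha> i a)" if "a \<in> A i" for a
      using that by force
    let ?P = "{(a, b). a \<in> A i \<and> b \<in> T \<alpha> i a}"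
    have finT: "finite (T \<alpha> i a)" for a using finB by (auto simp: T_def)
    have "?P = (SIGMA a:A i. T \<alpha> i a)" by auto
    then have "real (card ?P) = (\<Sum>a\<in>A i. real (card (T \<alpha> i a)))"
      using finA[OF i] finT by simp
    also have "\<dots> \<ge> (\<Sum>a\<in>A i. \<tau> i * card B)"
      by (intro sum_mono large)
    finally have "\<tau> i * card B * card (A i) \<le> card ?P"
      by (simp add: mult.commute)
    then have "(\<Sum>i'\<in>{1..<i}. D i' + 2 * real r * \<Delta>) * card (A i) < card {(a, b) \<in> ?P. {a, b} \<in> E}"
      by (intro regular i family)
    also have "{(a, b) \<in> ?P. {a, b} \<in> E} = (SIGMA a:A i. {b\<in>T \<alpha> i a. {a, b} \<in> E})" by auto
    also have "real (card \<dots>) = (\<Sum>a\<in>A i. real (card {b\<in>T \<alpha> i a. {a, b} \<in> E}))"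
      using finA[OF i] finT by simp
    also have "\<dots> \<le> (\<Sum>a\<in>A i. \<Sum>i'\<in>{1..<i}. D i' + 2 * real r * \<Delta>)"
      by (intro sum_mono step_edges i \<alpha>)
    finally show False by (simp add: mult.commute)
  qed

  have "\<exists>\<alpha>. \<forall>i\<in>{1..m}. \<alpha> i \<in> A i \<and> card (T \<alpha> i (\<alpha> i)) < \<tau> i * card B" if "m \<le> r" for m
    using that
  proof (induction m)
    case (Suc m)
    then obtain \<alpha> where \<alpha>: "\<forall>i\<in>{1..m}. \<alpha> i \<in> A i \<and> card (T \<alpha> i (\<alpha> i)) < \<tau> i * card B"
      by auto
    then obtain a where a: "a \<in> A (Suc m)" "card (T \<alpha> (Suc m) a) < \<tau> (Suc m) * card B"
      using step[of "Suc m" \<alpha>] Suc.prems by auto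
    define \<beta> where "\<beta> = \<alpha>(Suc m := a)"
    \<comment> \<open>\<open>T \<alpha> i\<close> reads \<open>\<alpha>\<close> only at indices
      below \<open>i\<close>, so fixing the value at \<open>Suc m\<close> leaves the earlier steps
      intact.\<close>
    have T: "T \<beta> i = T \<alpha> i" if "i \<le> Suc m" for i
      using that by (auto simp: T_def \<beta>_def)
    have "\<beta> i \<in> A i \<and> card (T \<beta> i (\<beta> i)) < \<tau> i * card B" if "i \<in> {1..Suc m}" for i
      using that \<alpha> a by (cases "i = Suc m") (auto simp: T, auto simp: \<beta>_def)
    then show ?case by blast
  qed simp
  then obtain \<alpha> where \<alpha>: "\<And>i. i \<in> {1..r} \<Longrightarrow> card (T \<alpha> i (\<alpha> i)) < \<tau> i * card B"
    by blast

  \<comment> \<open>Pigeonhole: a vertex \<open>b\<close> outside all these sets would get a class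
    \<open>J i\<close> for each \<open>i\<close>. For \<open>i' < i\<close> the window of
    \<open>\<alpha> i'\<close> contains \<open>b\<close> in class \<open>J i'\<close> but not in
    class \<open>J i\<close>, so \<open>r\<close> distinct classes would be needed among
    \<open>k < r\<close>.\<close>
  have "B \<subseteq> (\<Union>i\<in>{1..r}. T \<alpha> i (\<alpha> i))"
  proof
    fix b assume "b \<in> B"
    show "b \<in> (\<Union>i\<in>{1..r}. T \<alpha> i (\<alpha> i))"
    proof (rule ccontr)
      assume "\<not> ?thesis"
      then have "\<forall>i\<in>{1..r}. \<exists>j<k. b \<in> S (\<alpha> i) j \<and> (\<forall>i'\<in>{1..<i}. b \<notin> S (\<alpha> i') j)"
        using \<open>b \<in> B\<close> by (auto simp: T_def)
      then obtain J where J: "\<And>i. i \<in> {1..r} \<Longrightarrow> J i < k" "\<And>i. i \<in> {1..r} \<Longrightarrow> b \<in> S (\<alpha> i) (J i)"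
          "\<And>i i'. i \<in> {1..r} \<Longrightarrow> i' \<in> {1..<i} \<Longrightarrow> b \<notin> S (\<alpha> i') (J i)"
        by metis
      have "inj_on J {1..r}"
      proof (rule linorder_inj_onI)
        fix i' i assume "i' < i" "i' \<in> {1..r}" "i \<in> {1..r}"
        then show "J i' \<noteq> J i" using J(2)[of i'] J(3)[of i i'] by auto
      qed auto
      then have "card {1..r} \<le> card {..<k}"
        using J(1) by (intro card_inj_on_le[of J]) auto
      then show False using \<open>k < r\<close> by simp
    qed
  qed
  then have "card B \<le> card (\<Union>i\<in>{1..r}. T \<alpha> i (\<alpha> i))"
    using finB by (intro card_mono) (auto simp: T_def)
  also have "\<dots> \<le> (\<Sum>i\<in>{1..r}. card (T \<alpha> i (\<alpha> i)))"
    by (rule card_UN_le) simp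
  finally have "real (card B) \<le> (\<Sum>i\<in>{1..r}. real (card (T \<alpha> i (\<alpha> i))))"
    by (simp flip: of_nat_sum)
  also have "\<dots> < (\<Sum>i\<in>{1..r}. \<tau> i * card B)"
    using \<alpha> \<open>k < r\<close> by (intro sum_strict_mono) auto
  also have "\<dots> \<le> 1 * real (card B)"
    unfolding sum_distrib_right[symmetric] by (intro mult_right_mono \<tau>) simp
  finally show False by simp
qed

section \<open>Pseudorandom bipartite graphs\<close>

text \<open>Stated for the indicator of triples \<open>(i, a, b)\<close>, where the choices are
  independent, rather than for the graph. In the application \<open>d\<close> is the mean number of
  neighbours of a vertex of \<open>B\<close> in each \<open>A i\<close>. Degrees stay below twice
  their means, and every large family member gets more than half its mean number of edges.\<close>

definition regular_edges ::
    "nat \<Rightarrow> (nat \<Rightarrow> 'a set) \<Rightarrow> 'a set \<Rightarrow> (nat \<Rightarrow> real) \<Rightarrow> real \<Rightarrow> (nat \<Rightarrow> real) \<Rightarrow> (nat \<times> 'a \<times> 'a \<Rightarrow> bool) \<Rightarrow> bool"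
  where "regular_edges r A B p d \<tau> f \<longleftrightarrow>
     (\<forall>b\<in>B. card {q \<in> (SIGMA i:{1..r}. A i \<times> {b}). f q} < 2 * (real r * d)) \<and>
     (\<forall>i\<in>{1..r}. \<forall>a\<in>A i. card {q \<in> {i} \<times> {a} \<times> B. f q} < 2 * (real (card B) * p i)) \<and>
     (\<forall>i\<in>{1..r}. \<forall>P\<in>threshold_complements r (A i) B. \<tau> i * real (card B) * real (card (A i)) \<le> real (card P) \<longrightarrow>
        p i * real (card P) / 2 < card {q \<in> {i} \<times> P. f q})"

section \<open>Union bound for the failure of regularity\<close>

lemma measure_pmf_UNION_le:
  fixes y :: real
  assumes "finite S" "\<And>x. x \<in> S \<Longrightarrow> measure_pmf.prob M (X x) \<le> y"
  shows "measure_pmf.prob M (\<Union>x\<in>S. X x) \<le> card S * y"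
proof -
  have "measure_pmf.prob M (\<Union>x\<in>S. X x) \<le> (\<Sum>x\<in>S. measure_pmf.prob M (X x))"
    using assms(1) by (intro measure_UNION_le) auto
  also have "\<dots> \<le> card S * y"
    using assms(2) by (rule sum_bounded_above)
  finally show ?thesis .
qed

text \<open>The three summands belong to the degrees in \<open>B\<close>, the degrees in the
  \<open>A i\<close>, and the edge counts. For the last, a large \<open>P\<close> has mean at least
  \<open>\<tau> i * n * (card (A i) * p i)\<close>, which is at least \<open>t * n * d\<close>; the
  size of the family is bounded using \<open>card (A i) \<le> card B\<close>.\<close>

lemma prob_not_regular_edges:
  fixes A :: "nat \<Rightarrow> 'a set" and B :: "'a set" and p \<tau> :: "nat \<Rightarrow> real" and d t :: real
  assumes finB: "finite B" and finA: "\<And>i. i \<in> {1..r} \<Longrightarrow> finite (A i)"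
    and p: "\<And>i. i \<in> {1..r} \<Longrightarrow> 0 \<le> p i \<and> p i \<le> 1"
    and d: "\<And>i. i \<in> {1..r} \<Longrightarrow> card (A i) * p i = d" "\<And>i. i \<in> {1..r} \<Longrightarrow> d \<le> card B * p i"
    and AB: "\<And>i. i \<in> {1..r} \<Longrightarrow> card (A i) \<le> card B"
    and t: "\<And>i. i \<in> {1..r} \<Longrightarrow> t \<le> \<tau> i" and "0 \<le> d"
  defines "n \<equiv> real (card B)"
  shows "measure_pmf.prob (Pi_pmf (SIGMA i:{1..r}. A i \<times> B) False (\<lambda>(i, a, b). bernoulli_pmf (p i)))
           {f. \<not> regular_edges r A B p d \<tau> f}
         \<le> n * exp (- (r * d) / 4) + r * (n * exp (- d / 4))
            + r * ((n + 1) ^ (4 * r * card B) * exp (- (t * n * d) / 10))"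
proof -
  let ?I = "SIGMA i:{1..r}. A i \<times> B"
  have finI: "finite ?I" using finA finB by auto
  define M where "M = Pi_pmf ?I False (\<lambda>q. bernoulli_pmf (p (fst q)))"
  have M: "Pi_pmf ?I False (\<lambda>(i, a, b). bernoulli_pmf (p i)) = M"
    by (simp add: M_def case_prod_unfold)
  have pI: "\<And>q. q \<in> ?I \<Longrightarrow> 0 \<le> p (fst q) \<and> p (fst q) \<le> 1" using p by auto
  note upper = prob_card_ge_Pi_pmf_bernoulli[where I = ?I and p = "\<lambda>q. p (fst q)", OF finI _ pI, folded M_def]
  note lower = prob_card_le_Pi_pmf_bernoulli[where I = ?I and p = "\<lambda>q. p (fst q)", OF finI _ pI, folded M_def]
  have sum_single: "(\<Sum>q\<in>{i} \<times> P. p (fst q)) = p i * card P" for i and P :: "('a \<times> 'a) set"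
  proof -
    have "(\<Sum>q\<in>{i} \<times> P. p (fst q)) = (\<Sum>q\<in>{i} \<times> P. p i)" by (intro sum.cong) auto
    then show ?thesis by (simp add: card_cartesian_product)
  qed

  define X where "X b = {f. 2 * (r * d) \<le> card {q \<in> (SIGMA i:{1..r}. A i \<times> {b}). f q}}" for b :: 'a
  define Y where "Y i a = {f. 2 * (n * p i) \<le> card {q \<in> {i} \<times> {a} \<times> B. f q}}" for i and a :: 'a
  define Z where "Z i P = {f. card {q \<in> {i} \<times> P. f q} \<le> p i * card P / 2}" for i and P :: "('a \<times> 'a) set"
  define \<F> where "\<F> i = {P \<in> threshold_complements r (A i) B. \<tau> i * n * card (A i) \<le> card P}" for i

  have "measure_pmf.prob M (X b) \<le> exp (- (r * d) / 4)" if "b \<in> B" for b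
  proof -
    have "(\<Sum>q\<in>(SIGMA i:{1..r}. A i \<times> {b}). p (fst q)) = (\<Sum>i\<in>{1..r}. \<Sum>ab\<in>A i \<times> {b}. p i)"
      using finA by (subst sum.Sigma) (auto simp: case_prod_unfold)
    also have "\<dots> = (\<Sum>i\<in>{1..r}. d)"
      using d(1) by (intro sum.cong) (auto simp: card_cartesian_product)
    finally show ?thesis
      unfolding X_def using that by (intro upper) auto
  qed
  then have X: "measure_pmf.prob M (\<Union>b\<in>B. X b) \<le> n * exp (- (r * d) / 4)"
    unfolding n_def by (intro measure_pmf_UNION_le finB)

  have "measure_pmf.prob M (\<Union>a\<in>A i. Y i a) \<le> n * exp (- d / 4)" if i: "i \<in> {1..r}" for i
  proof -
    have "measure_pmf.prob M (Y i a) \<le> exp (- d / 4)" if a: "a \<in> A i" for a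
    proof -
      have "measure_pmf.prob M (Y i a) \<le> exp (- (n * p i) / 4)"
        unfolding Y_def
      proof (rule upper)
        show "{i} \<times> {a} \<times> B \<subseteq> ?I" using i a by auto
        show "(\<Sum>q\<in>{i} \<times> {a} \<times> B. p (fst q)) \<le> n * p i"
          unfolding sum_single by (simp add: card_cartesian_product n_def)
      qed
      also have "\<dots> \<le> exp (- d / 4)" using d(2)[OF i] by (simp add: n_def)
      finally show ?thesis .
    qed
    then have "measure_pmf.prob M (\<Union>a\<in>A i. Y i a) \<le> card (A i) * exp (- d / 4)"
      by (intro measure_pmf_UNION_le finA i)
    also have "\<dots> \<le> n * exp (- d / 4)"
      using AB[OF i] by (intro mult_right_mono) (auto simp: n_def)
    finally show ?thesis .
  qed
  then have Y: "measure_pmf.prob M (\<Union>i\<in>{1..r}. \<Union>a\<in>A i. Y i a) \<le> r * (n * exp (- d / 4))"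
    using measure_pmf_UNION_le[of "{1..r}" M "\<lambda>i. \<Union>a\<in>A i. Y i a"] by simp

  have "measure_pmf.prob M (\<Union>P\<in>\<F> i. Z i P) \<le> (n + 1) ^ (4 * r * card B) * exp (- (t * n * d) / 10)"
    if i: "i \<in> {1..r}" for i
  proof -
    have finF: "finite (\<F> i)"
      using finite_threshold_complements[OF finA[OF i] finB] by (simp add: \<F>_def)
    have "measure_pmf.prob M (Z i P) \<le> exp (- (t * n * d) / 10)" if P: "P \<in> \<F> i" for P
    proof -
      have "P \<subseteq> A i \<times> B"
        using P by (intro threshold_complements_subset[of P r]) (simp add: \<F>_def)
      then have "{i} \<times> P \<subseteq> ?I" using i by auto
      then have prob: "measure_pmf.prob M (Z i P) \<le> exp (- (p i * card P) / 10)"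
        unfolding Z_def using lower[of "{i} \<times> P"] by (simp add: sum_single)
      have "t * n * d \<le> \<tau> i * n * d"
        using t[OF i] \<open>0 \<le> d\<close> by (intro mult_right_mono) (auto simp: n_def)
      then have "t * n * d \<le> p i * (\<tau> i * n * card (A i))"
        by (simp add: d(1)[OF i, symmetric] mult_ac)
      also have "\<dots> \<le> p i * card P"
        using P p[OF i] by (intro mult_left_mono) (auto simp: \<F>_def)
      finally show ?thesis
        by (intro order_trans[OF prob]) simp
    qed
    then have "measure_pmf.prob M (\<Union>P\<in>\<F> i. Z i P) \<le> card (\<F> i) * exp (- (t * n * d) / 10)"
      by (intro measure_pmf_UNION_le finF)
    also have "card (\<F> i) \<le> card (threshold_complements r (A i) B)"
      using finite_threshold_complements[OF finA[OF i] finB] by (intro card_mono) (auto simp: \<F>_def)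
    also have "\<dots> \<le> (card B + 1) ^ (2 * r * (card B + card (A i)))"
      by (rule card_threshold_complements[OF finA[OF i] finB])
    also have "\<dots> \<le> (card B + 1) ^ (4 * r * card B)"
      using AB[OF i] by (intro power_increasing) auto
    finally show ?thesis by (simp add: n_def mult_right_mono add.commute)
  qed
  then have Z: "measure_pmf.prob M (\<Union>i\<in>{1..r}. \<Union>P\<in>\<F> i. Z i P)
      \<le> r * ((n + 1) ^ (4 * r * card B) * exp (- (t * n * d) / 10))"
    using measure_pmf_UNION_le[of "{1..r}" M "\<lambda>i. \<Union>P\<in>\<F> i. Z i P"] by simp

  have "{f. \<not> regular_edges r A B p d \<tau> f}
      \<subseteq> ((\<Union>b\<in>B. X b) \<union> (\<Union>i\<in>{1..r}. \<Union>a\<in>A i. Y i a)) \<union> (\<Union>i\<in>{1..r}. \<Union>P\<in>\<F> i. Z i P)"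
    unfolding regular_edges_def X_def Y_def Z_def \<F>_def n_def by (auto simp: not_less)
  then have "measure_pmf.prob M {f. \<not> regular_edges r A B p d \<tau> f}
      \<le> measure_pmf.prob M (((\<Union>b\<in>B. X b) \<union> (\<Union>i\<in>{1..r}. \<Union>a\<in>A i. Y i a)) \<union> (\<Union>i\<in>{1..r}. \<Union>P\<in>\<F> i. Z i P))"
    by (intro measure_pmf.finite_measure_mono) auto
  also have "\<dots> \<le> measure_pmf.prob M (\<Union>b\<in>B. X b) + measure_pmf.prob M (\<Union>i\<in>{1..r}. \<Union>a\<in>A i. Y i a)
      + measure_pmf.prob M (\<Union>i\<in>{1..r}. \<Union>P\<in>\<F> i. Z i P)"
    by (intro order_trans[OF measure_Un_le] add_mono) auto
  finally show ?thesis
    unfolding M using X Y Z by linarith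
qed

text \<open>Disjointness of the parts lets each edge at a given vertex be traced back to a triple
  counted by \<open>regular_edges\<close>. The hypothesis \<open>small\<close> compares the window
  bounds with half the mean edge count per vertex; its term \<open>4 * (real r)\<^sup>2 * d\<close>
  is \<open>2 * r\<close> times the bound \<open>2 * r * d\<close> on degrees in
  \<open>B\<close>.\<close>

lemma regular_edges_interval_thickness:
  fixes A :: "nat \<Rightarrow> 'a set" and B :: "'a set" and p \<tau> :: "nat \<Rightarrow> real" and d :: real
  assumes finB: "finite B" and finA: "\<And>i. i \<in> {1..r} \<Longrightarrow> finite (A i)"
    and disjA: "disjoint_family_on A {1..r}" and disjB: "(\<Union>i\<in>{1..r}. A i) \<inter> B = {}"
    and "0 \<le> d" and p: "\<And>i. i \<in> {1..r} \<Longrightarrow> 0 \<le> p i"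
    and reg: "regular_edges r A B p d \<tau> f"
    and small: "\<And>i. i \<in> {1..r} \<Longrightarrow>
       (\<Sum>i'\<in>{1..<i}. 2 * (card B * p i') + 4 * (real r)\<^sup>2 * d) \<le> card B * p i * \<tau> i / 2"
    and \<tau>: "(\<Sum>i\<in>{1..r}. \<tau> i) \<le> 1"
  shows "r \<le> interval_thickness ((\<Union>i\<in>{1..r}. A i) \<union> B)
           {{a, b} | i a b. i \<in> {1..r} \<and> a \<in> A i \<and> b \<in> B \<and> f (i, a, b)}"
    (is "_ \<le> interval_thickness ?V ?E")
proof (rule ccontr)
  define E where "E = ?E"
  assume "\<not> ?thesis"
  then have "interval_thickness ?V E < r" by (simp only: E_def not_le)
  define h where "h = (\<lambda>(i :: nat, a :: 'a, b). {a, b})"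
  have E: "E = h ` {q \<in> (SIGMA i:{1..r}. A i \<times> B). f q}"
    unfolding E_def by (fastforce simp: h_def image_iff)
  have finE: "finite E"
  proof -
    have "finite (SIGMA i:{1..r}. A i \<times> B)" using finA finB by auto
    then show ?thesis
      unfolding E by (intro finite_imageI) (rule finite_subset[rotated], auto)
  qed
  \<comment> \<open>The core lemma wants a natural degree bound; rounding down is harmless because
    degrees are integers.\<close>
  define \<Delta> where "\<Delta> = nat \<lfloor>2 * (real r * d)\<rfloor>"
  have \<Delta>: "real \<Delta> \<le> 2 * (real r * d)"
    unfolding \<Delta>_def using \<open>0 \<le> d\<close> by (intro of_nat_floor) auto
  have "\<not> interval_decomposable ?V E (interval_thickness ?V E)"
  proof (rule not_interval_decomposable[where A = A and B = B and \<tau> = \<tau> and \<Delta> = \<Delta> and r = r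
        and D = "\<lambda>i. 2 * (card B * p i)"])
    fix b assume b: "b \<in> B"
    let ?Q = "{q \<in> (SIGMA i:{1..r}. A i \<times> {b}). f q}"
    have "finite (SIGMA i:{1..r}. A i \<times> {b})" using finA by auto
    then have finQ: "finite ?Q" by (rule finite_subset[rotated]) auto
    have "{e\<in>E. b \<in> e} \<subseteq> h ` ?Q"
    proof
      fix e assume "e \<in> {e\<in>E. b \<in> e}"
      then obtain i a b' where q: "i \<in> {1..r}" "a \<in> A i" "b' \<in> B" "f (i, a, b')" "e = {a, b'}" "b \<in> e"
        unfolding E_def by blast
      moreover have "b' = b" using q b disjB by blast
      ultimately show "e \<in> h ` ?Q"
        by (intro image_eqI[of _ _ "(i, a, b)"]) (auto simp: h_def)
    qed
    then have "card {e\<in>E. b \<in> e} \<le> card ?Q"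
      using finQ by (meson card_image_le card_mono finite_imageI order_trans)
    moreover have "real (card ?Q) < 2 * (real r * d)"
      using reg b unfolding regular_edges_def by blast
    ultimately show "card {e\<in>E. b \<in> e} \<le> \<Delta>"
      unfolding \<Delta>_def by (intro le_nat_floor) linarith
  next
    fix i a assume i: "i \<in> {1..r}" and a: "a \<in> A i"
    let ?Q = "{q \<in> {i} \<times> {a} \<times> B. f q}"
    have finQ: "finite ?Q" using finB by auto
    have "a \<notin> B" using disjB i a by blast
    have "{e\<in>E. a \<in> e} \<subseteq> h ` ?Q"
    proof
      fix e assume "e \<in> {e\<in>E. a \<in> e}"
      then obtain i' a' b where q: "i' \<in> {1..r}" "a' \<in> A i'" "b \<in> B" "f (i', a', b)" "e = {a', b}" "a \<in> e"
        unfolding E_def by blast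
      moreover have "a' = a" using q \<open>a \<notin> B\<close> by blast
      moreover have "i' = i"
        using q \<open>a' = a\<close> disjA i a unfolding disjoint_family_on_def by blast
      ultimately show "e \<in> h ` ?Q"
        by (intro image_eqI[of _ _ "(i, a, b)"]) (auto simp: h_def)
    qed
    then have "card {e\<in>E. a \<in> e} \<le> card ?Q"
      using finQ by (meson card_image_le card_mono finite_imageI order_trans)
    moreover have "real (card ?Q) < 2 * (card B * p i)"
      using reg i a unfolding regular_edges_def by blast
    ultimately show "real (card {e\<in>E. a \<in> e}) \<le> 2 * (card B * p i)"
      by linarith
  next
    fix i P
    assume i: "i \<in> {1..r}" and P: "P \<in> threshold_complements r (A i) B"
      and large: "\<tau> i * card B * card (A i) \<le> card P"
    have PAB: "P \<subseteq> A i \<times> B" using P by (rule threshold_complements_subset)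
    then have finP: "finite P" using finA[OF i] finB finite_subset by blast
    have "(\<Sum>i'\<in>{1..<i}. 2 * (card B * p i') + 2 * real r * \<Delta>)
        \<le> (\<Sum>i'\<in>{1..<i}. 2 * (card B * p i') + 4 * (real r)\<^sup>2 * d)"
    proof (intro sum_mono add_left_mono)
      show "2 * real r * \<Delta> \<le> 4 * (real r)\<^sup>2 * d"
        using mult_left_mono[OF \<Delta>, of "2 * real r"] by (simp add: power2_eq_square mult_ac)
    qed
    also have "\<dots> \<le> card B * p i * \<tau> i / 2" by (rule small[OF i])
    finally have "(\<Sum>i'\<in>{1..<i}. 2 * (card B * p i') + 2 * real r * \<Delta>) * card (A i)
        \<le> (card B * p i * \<tau> i / 2) * card (A i)"
      by (rule mult_right_mono) simp
    also have "\<dots> = p i * (\<tau> i * card B * card (A i)) / 2" by simp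
    also have "\<dots> \<le> p i * card P / 2"
      using p[OF i] large by (intro divide_right_mono mult_left_mono) auto
    also have "\<dots> < card {q \<in> {i} \<times> P. f q}"
      using reg i P large unfolding regular_edges_def by blast
    \<comment> \<open>The lower bound passes from triples to pairs: the first component is fixed, so
      \<open>snd\<close> is injective.\<close>
    also have "card {q \<in> {i} \<times> P. f q} \<le> card {(a, b) \<in> P. {a, b} \<in> E}"
    proof (rule card_inj_on_le[of snd])
      show "snd ` {q \<in> {i} \<times> P. f q} \<subseteq> {(a, b) \<in> P. {a, b} \<in> E}"
        using PAB i unfolding E_def by fastforce
      show "finite {(a, b) \<in> P. {a, b} \<in> E}"
        by (rule finite_subset[OF _ finP]) auto
    qed (auto intro: inj_onI)
    finally show "(\<Sum>i'\<in>{1..<i}. 2 * (card B * p i') + 2 * real r * \<Delta>) * card (A i)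
        < card {(a, b) \<in> P. {a, b} \<in> E}"
      by simp
  qed (use \<open>interval_thickness ?V E < r\<close> finE finA finB \<tau> in auto)
  then show False
    using interval_decomposable_interval_thickness[OF finE] by blast
qed

section \<open>The choice of parameters\<close>

lemma sum_geometric_below:
  fixes M :: real
  assumes "2 \<le> M"
  shows "(\<Sum>i\<in>{1..<Suc m}. M ^ i) \<le> 2 * M ^ m"
proof (induction m)
  case (Suc m)
  have "2 * M ^ m \<le> M * M ^ m" using assms by (intro mult_right_mono) auto
  then show ?case using Suc by simp
qed simp

text \<open>From \<open>m = 1\<close> on, raising \<open>m\<close> by one multiplies the left side
  by at most 4 and the right side by \<open>1000 * R\<close>. The factor \<open>2 ^ (m + 5)\<close>
  results from clearing denominators against the weight \<open>(1 / 2) ^ Suc i\<close> with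
  \<open>i = Suc m\<close>.\<close>

lemma slack_below_geometric:
  fixes R :: real
  assumes "1 \<le> R"
  shows "R\<^sup>2 * m * 2 ^ (m + 5) \<le> (1000 * R) ^ Suc m"
proof (cases m)
  case 0
  then show ?thesis using assms by simp
next
  case (Suc m')
  have "R\<^sup>2 * Suc m' * 2 ^ (Suc m' + 5) \<le> (1000 * R) ^ Suc (Suc m')"
  proof (induction m')
    case 0
    have "0 \<le> R * R" by simp
    then show ?case by (simp add: power2_eq_square)
  next
    case (Suc l)
    have "R\<^sup>2 * Suc (Suc l) * 2 ^ (Suc (Suc l) + 5) \<le> R\<^sup>2 * (2 * Suc l) * 2 ^ (Suc (Suc l) + 5)"
      by (intro mult_right_mono mult_left_mono) auto
    also have "\<dots> = 4 * (R\<^sup>2 * Suc l * 2 ^ (Suc l + 5))"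
      by (simp add: power_add algebra_simps)
    also have "\<dots> \<le> (1000 * R) * (1000 * R) ^ Suc (Suc l)"
      using Suc assms by (intro mult_mono) auto
    finally show ?case by simp
  qed
  then show ?thesis using Suc by simp
qed

lemma sum_weights_le_1:
  "(\<Sum>i\<in>{1..r}. 1 / (2 * real r) + (1 / 2) ^ Suc i) \<le> 1"
proof -
  have "(\<Sum>i\<in>{1..m}. (1 / 2 :: real) ^ Suc i) = 1 / 2 - (1 / 2) ^ Suc m" for m
    by (induction m) auto
  then have "(\<Sum>i\<in>{1..r}. (1 / 2 :: real) ^ Suc i) \<le> 1 / 2" by simp
  moreover have "(\<Sum>i\<in>{1..r}. 1 / (2 * real r)) \<le> 1 / 2" by simp
  ultimately show ?thesis by (simp only: sum.distrib)
qed

text \<open>Each summand of the weight pays for one term. The degrees of earlier vertices form a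
  geometric sum of order \<open>M ^ m\<close>, below
  \<open>M ^ Suc m / (4 * r) = 250 * M ^ m\<close>; the slack, linear in the number of earlier
  steps, is paid for by the power of 1/2.\<close>

lemma sum_degrees_le_weight:
  fixes d :: real
  assumes "1 \<le> r" "1 \<le> i" "0 \<le> d"
  defines "M \<equiv> 1000 * real r"
  shows "(\<Sum>i'\<in>{1..<i}. 2 * (d * M ^ i') + 4 * (real r)\<^sup>2 * d)
           \<le> d * M ^ i * (1 / (2 * real r) + (1 / 2) ^ Suc i) / 2"
proof -
  obtain m where i: "i = Suc m" using assms(2) by (cases i) auto
  have "2 * (\<Sum>i'\<in>{1..<i}. M ^ i') \<le> 2 * (2 * M ^ m)"
    unfolding i using sum_geometric_below[of M m] assms(1) by (intro mult_left_mono) (auto simp: M_def)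
  also have "\<dots> \<le> 250 * M ^ m" by (simp add: M_def)
  also have "\<dots> = M ^ i * (1 / (2 * real r)) / 2"
    using assms(1) by (simp add: i M_def field_simps)
  finally have "2 * (\<Sum>i'\<in>{1..<i}. M ^ i') \<le> M ^ i * (1 / (2 * real r)) / 2" .
  moreover have "4 * (real r)\<^sup>2 * m \<le> M ^ i * (1 / 2) ^ Suc i / 2"
    using slack_below_geometric[of "real r" m] assms(1)
    by (simp add: i M_def field_simps power_add)
  ultimately have "2 * (\<Sum>i'\<in>{1..<i}. M ^ i') + 4 * (real r)\<^sup>2 * m
      \<le> M ^ i * (1 / (2 * real r) + (1 / 2) ^ Suc i) / 2"
    by (simp only: distrib_left add_divide_distrib)
  then have "d * (2 * (\<Sum>i'\<in>{1..<i}. M ^ i') + 4 * (real r)\<^sup>2 * m)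
      \<le> d * (M ^ i * (1 / (2 * real r) + (1 / 2) ^ Suc i) / 2)"
    using assms(3) by (rule mult_left_mono)
  also have "d * (2 * (\<Sum>i'\<in>{1..<i}. M ^ i') + 4 * (real r)\<^sup>2 * m)
      = (\<Sum>i'\<in>{1..<i}. 2 * (d * M ^ i') + 4 * (real r)\<^sup>2 * d)"
    by (simp add: sum.distrib sum_distrib_left i algebra_simps)
  finally show ?thesis by (simp add: mult.assoc)
qed

text \<open>Each of the three terms is at most 1/8. The square root in the hypothesis comes from the
  crude bound of \<open>ln (N + 1)\<close> by \<open>2 * sqrt N\<close>: the family size is then at
  most \<open>exp (8 * r * s * N)\<close>, against a decay of at least
  \<open>exp (- (100 * r * s * N))\<close>.\<close>

lemma failure_probability_le_half:
  fixes d :: real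
  assumes "1 \<le> r" "1 \<le> N" and d: "10 ^ 6 * (real r)\<^sup>2 * sqrt N \<le> d"
  shows "N * exp (- (r * d) / 4) + r * (N * exp (- d / 4))
       + r * ((real N + 1) ^ (4 * r * N) * exp (- (1 / (2 * real r) * N * d) / 10)) \<le> 1 / 2"
proof -
  define s where "s = sqrt N"
  have s: "1 \<le> s" "s\<^sup>2 = N" using assms(2) by (auto simp: s_def)
  have r: "1 \<le> real r" using assms(1) by simp
  have rs: "1 \<le> real r * s" using r s by (metis mult_mono' mult_1 zero_le_one)
  have "0 \<le> d" using d s_def s(1) by (smt (verit) mult_nonneg_nonneg zero_le_power2 zero_le_power)
  have r2: "real r \<le> (real r)\<^sup>2" using r by (simp add: power2_eq_square)
  have d1: "100 * (real r * s) \<le> d / 4"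
  proof -
    have "400 * real r \<le> 10 ^ 6 * real r" by simp
    also have "\<dots> \<le> 10 ^ 6 * (real r)\<^sup>2" by (intro mult_left_mono r2) simp
    finally have "400 * real r \<le> 10 ^ 6 * (real r)\<^sup>2" .
    then have "400 * (real r * s) \<le> 10 ^ 6 * (real r)\<^sup>2 * s"
      unfolding mult.assoc[symmetric] using s by (intro mult_right_mono) auto
    also have "\<dots> \<le> d" using d by (simp add: s_def)
    finally show ?thesis by simp
  qed
  have e: "real r * (N * exp (- d / 4)) \<le> 1 / 8"
  proof -
    define x where "x = 100 * (real r * s)"
    have x: "0 \<le> x" using rs by (simp add: x_def)
    have "8 * (real r * N) \<le> 5000 * ((real r)\<^sup>2 * N)"
      by (intro mult_mono r2) auto
    also have "\<dots> = x\<^sup>2 / 2"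
      by (simp add: x_def power_mult_distrib s)
    also have "\<dots> \<le> exp x"
      using exp_lower_Taylor_quadratic[OF x] x by linarith
    also have "\<dots> \<le> exp (d / 4)" using d1 by (simp add: x_def)
    finally show ?thesis by (simp add: exp_minus field_simps)
  qed
  \<comment> \<open>This term is dominated by the one just bounded, because
    \<open>d \<le> r * d\<close>.\<close>
  have "N * exp (- (r * d) / 4) \<le> 1 / 8"
  proof -
    have "d \<le> r * d" using r \<open>0 \<le> d\<close> by (simp add: mult_le_cancel_right1)
    then have "1 * (N * exp (- (r * d) / 4)) \<le> real r * (N * exp (- d / 4))"
      using r by (intro mult_mono) auto
    then show ?thesis using e by (simp only: mult_1)
  qed
  moreover have "r * ((real N + 1) ^ (4 * r * N) * exp (- (1 / (2 * real r) * N * d) / 10)) \<le> 1 / 8"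
  proof -
    have "real N + 1 \<le> (1 + s)\<^sup>2" using s by (simp add: power2_eq_square algebra_simps)
    also have "\<dots> \<le> (exp s)\<^sup>2" using s by (intro power_mono exp_ge_add_one_self) auto
    also have "\<dots> = exp (2 * s)" by (simp add: exp_double)
    finally have "(real N + 1) ^ (4 * r * N) \<le> exp (2 * s) ^ (4 * r * N)" by (intro power_mono) auto
    also have "\<dots> = exp (8 * (r * s * N))" by (simp add: exp_of_nat_mult[symmetric] mult_ac)
    finally have *: "(real N + 1) ^ (4 * r * N) \<le> exp (8 * (r * s * N))" .
    have "20 * real r * (100 * (r * s * N)) = 2000 * (real r)\<^sup>2 * s * N"
      by (simp add: power2_eq_square)
    also have "\<dots> \<le> (10 ^ 6 * (real r)\<^sup>2 * s) * N"
      using s by (intro mult_right_mono) auto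
    also have "\<dots> \<le> d * N" using d by (intro mult_right_mono) (auto simp: s_def)
    finally have **: "100 * (r * s * N) \<le> (1 / (2 * real r) * N * d) / 10"
      using r by (simp add: field_simps)
    have "real r * 1 \<le> (r * s) * N"
      using s r assms(2) by (intro mult_mono) auto
    then have rsN: "real r \<le> r * s * N" by simp
    have "(real N + 1) ^ (4 * r * N) * exp (- (1 / (2 * real r) * N * d) / 10)
        \<le> exp (8 * (r * s * N)) * exp (- (100 * (r * s * N)))"
      using ** by (intro mult_mono *) auto
    also have "\<dots> = exp (- (92 * (r * s * N)))" by (simp flip: exp_add)
    also have "\<dots> \<le> exp (- (8 * r))" using rsN r by simp
    finally have "r * ((real N + 1) ^ (4 * r * N) * exp (- (1 / (2 * real r) * N * d) / 10))
        \<le> r * exp (- (8 * real r))" by (intro mult_left_mono) auto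
    moreover have "8 * real r \<le> exp (8 * real r)"
      using exp_ge_add_one_self[of "8 * real r"] by linarith
    then have "r * exp (- (8 * real r)) \<le> 1 / 8"
      by (simp add: exp_minus field_simps)
    ultimately show ?thesis by (rule order_trans)
  qed
  ultimately have "N * exp (- (r * d) / 4) + r * (N * exp (- d / 4))
       + r * ((real N + 1) ^ (4 * r * N) * exp (- (1 / (2 * real r) * N * d) / 10)) \<le> 1 / 8 + 1 / 8 + 1 / 8"
    by (intro add_mono e)
  then show ?thesis by (rule order_trans) simp
qed

theorem theorem2p1:
  "\<exists>c::real. \<forall>C::real. C > 0 \<longrightarrow> C \<ge> c \<longrightarrow> (\<forall>r::nat. r \<ge> 1 \<longrightarrow>
    (let \<delta> = inverse (1000 * real r);
         \<epsilon> = \<delta> ^ (r + 2);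
         n = C * (1000 * real r) ^ (1000 * r)
     in \<forall>(A :: nat \<Rightarrow> 'a set) (B :: 'a set).
          finite B \<longrightarrow> real (card B) = n \<longrightarrow>
          (\<forall>i\<in>{1..r}. finite (A i) \<and> real (card (A i)) = n * \<delta> ^ i) \<longrightarrow>
          disjoint_family_on A {1..r} \<longrightarrow>
          (\<Union>i\<in>{1..r}. A i) \<inter> B = {} \<longrightarrow>
          measure_pmf.prob (random_bipartite_edges r A B (\<lambda>i. \<epsilon> / \<delta> ^ i))
            {E. interval_thickness ((\<Union>i\<in>{1..r}. A i) \<union> B) E \<ge> r} \<ge> 1 / 2))"
proof -
  have main: "1 / 2 \<le> measure_pmf.prob (random_bipartite_edges r A B (\<lambda>i. \<epsilon> / \<delta> ^ i))
            {E. interval_thickness ((\<Union>i\<in>{1..r}. A i) \<union> B) E \<ge> r}"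
    if C: "1 \<le> C" and r: "1 \<le> r" and \<delta>: "\<delta> = inverse (1000 * real r)" and \<epsilon>: "\<epsilon> = \<delta> ^ (r + 2)"
      and n: "n = C * (1000 * real r) ^ (1000 * r)"
      and finB: "finite B" and cardB: "real (card B) = n"
      and A: "\<forall>i\<in>{1..r}. finite (A i) \<and> real (card (A i)) = n * \<delta> ^ i"
      and disjA: "disjoint_family_on A {1..r}" and disjB: "(\<Union>i\<in>{1..r}. A i) \<inter> B = {}"
    for C \<delta> \<epsilon> n :: real and r and A :: "nat \<Rightarrow> 'a set" and B :: "'a set"
  proof -
    define M where "M = 1000 * real r"
    have M: "1000 \<le> M" using r by (simp add: M_def)
    have \<delta>M: "\<delta> = 1 / M" by (simp add: \<delta> M_def inverse_eq_divide)
    have \<delta>01: "0 < \<delta>" "\<delta> \<le> 1" using M by (auto simp: \<delta>M)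
    \<comment> \<open>With \<open>M = 1 / \<delta>\<close>, the sizes and probabilities cancel to
      \<open>card (A i) * p i = d\<close> for every \<open>i\<close>, while the mean degree in
      \<open>A i\<close> is \<open>d * M ^ i\<close> and grows by the factor \<open>M\<close> from
      one part to the next.\<close>
    define d where "d = n * \<epsilon>"
    define p where "p i = \<epsilon> / \<delta> ^ i" for i
    \<comment> \<open>The first summand absorbs the degrees of earlier vertices, the second one the slack from the degrees in \<open>B\<close>.\<close>
    define \<tau> where "\<tau> i = 1 / (2 * real r) + (1 / 2 :: real) ^ Suc i" for i
    have nM: "M ^ (1000 * r) \<le> n"
      using mult_right_mono[OF C, of "M ^ (1000 * r)"] M by (simp add: n M_def)
    then have n1: "1 \<le> n" using M one_le_power[of M "1000 * r"] by linarith
    then have B: "1 \<le> card B" using cardB by auto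
    have \<epsilon>0: "0 < \<epsilon>" using \<delta>01 by (simp add: \<epsilon>)
    have "0 < d" using n1 \<epsilon>0 by (simp add: d_def)
    have p: "0 \<le> p i \<and> p i \<le> 1" if "i \<in> {1..r}" for i
    proof -
      have "\<epsilon> \<le> \<delta> ^ i"
        unfolding \<epsilon> using that \<delta>01 by (intro power_decreasing) auto
      then show ?thesis using \<epsilon>0 \<delta>01 by (simp add: p_def)
    qed
    have np: "card B * p i = d * M ^ i" for i
      by (simp add: cardB p_def d_def \<delta>M power_one_over)
    \<comment> \<open>Here \<open>sqrt n\<close> is at least \<open>M ^ (500 * r)\<close> and
      \<open>\<epsilon>\<close> is \<open>M\<close> to the power \<open>- (r + 2)\<close>. The
      remaining exponent is at least 2, and
      \<open>M ^ 2 = 10 ^ 6 * (real r)\<^sup>2\<close>.\<close>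
    have "sqrt n * (10 ^ 6 * (real r)\<^sup>2) \<le> sqrt n * (sqrt n * \<epsilon>)"
    proof (rule mult_left_mono)
      have "10 ^ 6 * (real r)\<^sup>2 = M ^ 2"
        by (simp add: M_def power2_eq_square)
      also have "\<dots> \<le> M ^ (500 * r - (r + 2))"
        using r M by (intro power_increasing) auto
      also have "\<dots> = M ^ (500 * r) * \<epsilon>"
        unfolding \<epsilon> \<delta>M power_one_over using r M by (subst power_diff) auto
      also have "M ^ (500 * r) \<le> sqrt n"
        using nM by (intro real_le_rsqrt) (simp flip: power_mult)
      finally show "10 ^ 6 * (real r)\<^sup>2 \<le> sqrt n * \<epsilon>"
        using \<epsilon>0 by simp
    qed (use n1 in simp)
    then have d: "10 ^ 6 * (real r)\<^sup>2 * sqrt (card B) \<le> d"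
      using n1 by (simp add: cardB d_def mult_ac flip: mult.assoc)
    let ?D = "Pi_pmf (SIGMA i:{1..r}. A i \<times> B) False (\<lambda>(i, a, b). bernoulli_pmf (p i))"
    have "measure_pmf.prob ?D {f. \<not> regular_edges r A B p d \<tau> f}
        \<le> card B * exp (- (r * d) / 4) + r * (card B * exp (- d / 4))
            + r * ((real (card B) + 1) ^ (4 * r * card B) * exp (- (1 / (2 * real r) * card B * d) / 10))"
    proof (rule prob_not_regular_edges[OF finB _ p])
      fix i assume i: "i \<in> {1..r}"
      show "finite (A i)" using A i by blast
      have cA: "real (card (A i)) = n * \<delta> ^ i" using A i by blast
      show "card (A i) * p i = d" using \<delta>01 by (simp add: cA p_def d_def)
      have "1 \<le> M ^ i" using M by simp
      then show "d \<le> card B * p i"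
        unfolding np using \<open>0 < d\<close> by simp
      have "n * \<delta> ^ i \<le> n * 1"
        using \<delta>01 n1 by (intro mult_left_mono power_le_one) auto
      then show "card (A i) \<le> card B"
        using cA cardB by linarith
      show "1 / (2 * real r) \<le> \<tau> i" by (simp add: \<tau>_def)
    qed (use \<open>0 < d\<close> in auto)
    also have "\<dots> \<le> 1 / 2"
      by (rule failure_probability_le_half[OF r B d])
    finally have fail: "measure_pmf.prob ?D {f. \<not> regular_edges r A B p d \<tau> f} \<le> 1 / 2" .
    have "1 / 2 \<le> measure_pmf.prob ?D {f. regular_edges r A B p d \<tau> f}"
    proof -
      have "{f. regular_edges r A B p d \<tau> f} = space (measure_pmf ?D) - {f. \<not> regular_edges r A B p d \<tau> f}"
        by auto
      then show ?thesis
        using fail by (simp only: measure_pmf.prob_compl[of _ ?D] sets_measure_pmf UNIV_I)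
    qed
    also have "\<dots> \<le> measure_pmf.prob ?D
       {f. r \<le> interval_thickness ((\<Union>i\<in>{1..r}. A i) \<union> B)
           {{a, b} | i a b. i \<in> {1..r} \<and> a \<in> A i \<and> b \<in> B \<and> f (i, a, b)}}"
    proof (rule measure_pmf.finite_measure_mono)
      have "r \<le> interval_thickness ((\<Union>i\<in>{1..r}. A i) \<union> B)
           {{a, b} | i a b. i \<in> {1..r} \<and> a \<in> A i \<and> b \<in> B \<and> f (i, a, b)}"
        if "regular_edges r A B p d \<tau> f" for f
      proof (rule regular_edges_interval_thickness[OF finB _ disjA disjB _ _ that])
        fix i assume "i \<in> {1..r}"
        then show "(\<Sum>i'\<in>{1..<i}. 2 * (card B * p i') + 4 * (real r)\<^sup>2 * d) \<le> card B * p i * \<tau> i / 2"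
          unfolding np \<tau>_def M_def using r \<open>0 < d\<close> by (intro sum_degrees_le_weight) auto
      next
        show "sum \<tau> {1..r} \<le> 1" unfolding \<tau>_def by (rule sum_weights_le_1)
      qed (use A p \<open>0 < d\<close> in auto)
      then show "{f. regular_edges r A B p d \<tau> f} \<subseteq> {f. r \<le> interval_thickness ((\<Union>i\<in>{1..r}. A i) \<union> B)
           {{a, b} | i a b. i \<in> {1..r} \<and> a \<in> A i \<and> b \<in> B \<and> f (i, a, b)}}"
        by blast
    qed simp
    also have "\<dots> = measure_pmf.prob (random_bipartite_edges r A B p)
            {E. interval_thickness ((\<Union>i\<in>{1..r}. A i) \<union> B) E \<ge> r}"
      by (simp add: random_bipartite_edges_def vimage_def)
    also have "p = (\<lambda>i. \<epsilon> / \<delta> ^ i)" by (simp add: fun_eq_iff p_def)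
    finally show ?thesis .
  qed
  \<comment> \<open>The threshold 1 suffices: \<open>C \<ge> 1\<close> serves only to guarantee that
    \<open>n\<close> is at least \<open>M ^ (1000 * r)\<close>.\<close>
  show ?thesis
    unfolding Let_def by (intro exI[of _ 1] allI impI, rule main[OF _ _ refl refl refl])
qed

end
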